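(* For every $q\in[1,\infty)$, let $f_{q,1}:[2,4]\to\mathbb R$ and $f_{q,\infty}:\left[\frac12,1\right]\to\mathbb R$ be given by $$ f_{q,1}(t)=\left(2^{1-q}(4t-t^2)^{\frac q2}+t^q\right)^{\frac1q},\qquad f_{q,\infty}(t)=\left(2t^q+2^qt^{\frac q2}(1-t)^{\frac q2}\right)^{\frac1q}. $$ Then, for every $q\in[1,\infty)$, $$ K_{2,q,1}=\max\{f_{q,1}(t):\ t\in[2,4]\},\qquad K_{2,q,\infty}=\max\left\{f_{q,\infty}(t):\ t\in\left[\tfrac12,1\right]\right\}. $$ Moreover, $K_{2,q,1}=4$ and $K_{2,q,\infty}=2^{\frac1q}$ for every $q\in[2,\infty)$.
   Context: $\mathcal P(^2\mathbb R^2)$ is the real vector space of $2$-homogeneous polynomials $P(x,y)=ax^2+bxy+cy^2$ with $a,b,c\in\mathbb R$. For $1\le q<\infty$, $|P|_q=(|a|^q+|b|^q+|c|^q)^{1/q}$. For $1\le p\le\infty$, $\|P\|_p=\sup\{|P(x,y)|:\ \|(x,y)\|_{\ell_p^2}\le 1\}$, where $\|(x,y)\|_{\ell_p^2}=(|x|^p+|y|^p)^{1/p}$ for $p<\infty$ and $\max\{|x|,|y|\}$ for $p=\infty$. The constant $K_{2,q,p}$ is the smallest $K>0$ such that $|P|_q\le K\|P\|_p$ for all $P\in\mathcal P(^2\mathbb R^2)$. *)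

theory Defs
  imports "HOL-Analysis.Analysis"
begin

text \<open>The polynomial \<open>a x\<^sup>2 + b x y + c y\<^sup>2\<close> is \<open>HomPoly2 a b c\<close>.\<close>

datatype hom_poly2 = HomPoly2 (coeff_xx: real) (coeff_xy: real) (coeff_yy: real)

definition eval2 :: "hom_poly2 \<Rightarrow> real \<times> real \<Rightarrow> real" where
  "eval2 P z = coeff_xx P * (fst z)\<^sup>2 + coeff_xy P * fst z * snd z + coeff_yy P * (snd z)\<^sup>2"

definition coeff_norm :: "real \<Rightarrow> hom_poly2 \<Rightarrow> real" where
  "coeff_norm q P =
     (\<bar>coeff_xx P\<bar> powr q + \<bar>coeff_xy P\<bar> powr q + \<bar>coeff_yy P\<bar> powr q) powr (1 / q)"

text \<open>The exponent \<open>p\<close> ranges over \<open>[1, \<infinity>]\<close>; it is an extended real to allow \<open>p = \<infinity>\<close>.\<close>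

definition lp_norm :: "ereal \<Rightarrow> real \<times> real \<Rightarrow> real" where
  "lp_norm p z =
     (if p = \<infinity> then max \<bar>fst z\<bar> \<bar>snd z\<bar>
      else (\<bar>fst z\<bar> powr real_of_ereal p + \<bar>snd z\<bar> powr real_of_ereal p)
             powr (1 / real_of_ereal p))"

definition poly_norm :: "ereal \<Rightarrow> hom_poly2 \<Rightarrow> real" where
  "poly_norm p P = (SUP z\<in>{z. lp_norm p z \<le> 1}. \<bar>eval2 P z\<bar>)"

definition is_bound_const :: "real \<Rightarrow> ereal \<Rightarrow> real \<Rightarrow> bool" where
  "is_bound_const q p K \<longleftrightarrow> K > 0 \<and> (\<forall>P. coeff_norm q P \<le> K * poly_norm p P)"

text \<open>The constant \<open>K\<^bsub>2,q,p\<^esub>\<close>. For \<open>1 \<le> q\<close> and \<open>1 \<le> p\<close> the least element exists; see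
  \<open>is_bound_const_best_const\<close> and \<open>best_const_le\<close>.\<close>

definition best_const :: "real \<Rightarrow> ereal \<Rightarrow> real" where
  "best_const q p = (LEAST K. is_bound_const q p K)"

definition f_one :: "real \<Rightarrow> real \<Rightarrow> real" where
  "f_one q t = (2 powr (1 - q) * (4 * t - t\<^sup>2) powr (q / 2) + t powr q) powr (1 / q)"

definition f_inf :: "real \<Rightarrow> real \<Rightarrow> real" where
  "f_inf q t =
     (2 * t powr q + 2 powr q * t powr (q / 2) * (1 - t) powr (q / 2)) powr (1 / q)"

text \<open>The maximum of the values of \<open>f\<close> on \<open>S\<close> (\<open>Max\<close> is only meaningful for finite sets).
  It is attained for \<open>f_one\<close> and \<open>f_inf\<close>; see \<open>f_one_max\<close> and \<open>f_inf_max\<close>.\<close>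

definition max_on :: "(real \<Rightarrow> real) \<Rightarrow> real set \<Rightarrow> real" where
  "max_on f S = (GREATEST y. y \<in> f ` S)"

lemma max_on_attained:
  assumes "compact S" "S \<noteq> {}" "continuous_on S f"
  shows "max_on f S \<in> f ` S" and "\<And>t. t \<in> S \<Longrightarrow> f t \<le> max_on f S"
proof -
  obtain s where s: "s \<in> S" "\<And>t. t \<in> S \<Longrightarrow> f t \<le> f s"
    using continuous_attains_sup[OF assms] by blast
  have "max_on f S = f s"
    unfolding max_on_def by (rule Greatest_equality) (use s in auto)
  with s show "max_on f S \<in> f ` S" "\<And>t. t \<in> S \<Longrightarrow> f t \<le> max_on f S" by auto
qed

lemma f_one_max:
  assumes "q \<ge> 1"
  shows "max_on (f_one q) {2..4} \<in> f_one q ` {2..4}"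
    and "\<And>t. t \<in> {2..4} \<Longrightarrow> f_one q t \<le> max_on (f_one q) {2..4}"
proof -
  have nn: "0 \<le> 4 * t - t\<^sup>2" if "t \<in> {2..4}" for t :: real
  proof -
    have "4 * t - t\<^sup>2 = t * (4 - t)" by (simp add: power2_eq_square algebra_simps)
    with that show ?thesis by simp
  qed
  have "continuous_on {2..4} (f_one q)"
    unfolding f_one_def
    by (intro continuous_intros continuous_on_powr' ballI conjI impI) (use assms nn in auto)
  from max_on_attained[OF _ _ this]
  show "max_on (f_one q) {2..4} \<in> f_one q ` {2..4}"
    "\<And>t. t \<in> {2..4} \<Longrightarrow> f_one q t \<le> max_on (f_one q) {2..4}" by auto
qed

lemma f_inf_max:
  assumes "q \<ge> 1"
  shows "max_on (f_inf q) {1/2..1} \<in> f_inf q ` {1/2..1}"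
    and "\<And>t. t \<in> {1/2..1} \<Longrightarrow> f_inf q t \<le> max_on (f_inf q) {1/2..1}"
proof -
  have "continuous_on {1/2..1} (f_inf q)"
    unfolding f_inf_def
    by (intro continuous_intros continuous_on_powr' ballI conjI impI) (use assms in auto)
  from max_on_attained[OF _ _ this]
  show "max_on (f_inf q) {1/2..1} \<in> f_inf q ` {1/2..1}"
    "\<And>t. t \<in> {1/2..1} \<Longrightarrow> f_inf q t \<le> max_on (f_inf q) {1/2..1}" by auto
qed

lemma lp_norm_ge:
  assumes "p \<ge> 1"
  shows "\<bar>fst z\<bar> \<le> lp_norm p z" and "\<bar>snd z\<bar> \<le> lp_norm p z"
proof -
  have "\<bar>fst z\<bar> \<le> lp_norm p z \<and> \<bar>snd z\<bar> \<le> lp_norm p z"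
  proof (cases p)
    case (real r)
    with assms have r: "r \<ge> 1" by simp
    have *: "\<bar>x\<bar> \<le> (\<bar>x\<bar> powr r + \<bar>y\<bar> powr r) powr (1 / r)" for x y :: real
    proof -
      have "\<bar>x\<bar> = (\<bar>x\<bar> powr r) powr (1 / r)" using r by (simp add: powr_powr)
      also have "\<dots> \<le> (\<bar>x\<bar> powr r + \<bar>y\<bar> powr r) powr (1 / r)"
        using r by (intro powr_mono2) auto
      finally show ?thesis .
    qed
    show ?thesis using *[of "fst z" "snd z"] *[of "snd z" "fst z"] real
      by (simp add: lp_norm_def add.commute)
  qed (use assms in \<open>auto simp: lp_norm_def\<close>)
  then show "\<bar>fst z\<bar> \<le> lp_norm p z" "\<bar>snd z\<bar> \<le> lp_norm p z" by auto
qed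

lemma poly_norm_upper:
  assumes "p \<ge> 1" "lp_norm p z \<le> 1"
  shows "\<bar>eval2 P z\<bar> \<le> poly_norm p P"
  unfolding poly_norm_def
proof (rule cSUP_upper)
  show "bdd_above ((\<lambda>z. \<bar>eval2 P z\<bar>) ` {z. lp_norm p z \<le> 1})"
  proof (rule bdd_aboveI2)
    fix w assume "w \<in> {z. lp_norm p z \<le> 1}"
    then have w: "\<bar>fst w\<bar> \<le> 1" "\<bar>snd w\<bar> \<le> 1"
      using lp_norm_ge[OF assms(1), of w] by auto
    have 1: "\<bar>coeff_xx P * (fst w)\<^sup>2\<bar> \<le> \<bar>coeff_xx P\<bar>"
      "\<bar>coeff_yy P * (snd w)\<^sup>2\<bar> \<le> \<bar>coeff_yy P\<bar>"
      using w by (auto simp: abs_mult abs_square_le_1 intro!: mult_left_le)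
    have "\<bar>fst w * snd w\<bar> \<le> 1"
      using w by (simp add: abs_mult mult_le_one)
    then have 2: "\<bar>coeff_xy P * fst w * snd w\<bar> \<le> \<bar>coeff_xy P\<bar>"
      by (simp add: abs_mult mult.assoc mult_left_le)
    show "\<bar>eval2 P w\<bar> \<le> \<bar>coeff_xx P\<bar> + \<bar>coeff_xy P\<bar> + \<bar>coeff_yy P\<bar>"
      using 1 2 unfolding eval2_def by linarith
  qed
qed (use assms in simp)

lemma is_bound_const_exists:
  assumes "q \<ge> 1" "p \<ge> 1"
  shows "is_bound_const q p (6 * 3 powr (1 / q))"
  unfolding is_bound_const_def
proof (intro conjI allI)
  fix P
  define N where "N = poly_norm p P"
  have in_ball: "lp_norm p (1, 0) \<le> 1" "lp_norm p (0, 1) \<le> 1" "lp_norm p (1/2, 1/2) \<le> 1"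
  proof -
    have "lp_norm p (1/2, 1/2) \<le> 1"
    proof (cases p)
      case (real r)
      with assms have r: "r \<ge> 1" by simp
      have "(1/2) powr r \<le> (1/2) powr (1::real)" using r by (intro powr_mono') auto
      then have "((1/2) powr r + (1/2) powr r) powr (1 / r) \<le> 1"
        using r by (intro powr_le1) auto
      then show ?thesis using real by (simp add: lp_norm_def)
    qed (use assms in \<open>auto simp: lp_norm_def\<close>)
    then show "lp_norm p (1, 0) \<le> 1" "lp_norm p (0, 1) \<le> 1" "lp_norm p (1/2, 1/2) \<le> 1"
      by (auto simp: lp_norm_def)
  qed
  have a: "\<bar>coeff_xx P\<bar> \<le> N" and c: "\<bar>coeff_yy P\<bar> \<le> N"
    and b: "\<bar>coeff_xx P / 4 + coeff_xy P / 4 + coeff_yy P / 4\<bar> \<le> N"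
    using in_ball[THEN poly_norm_upper[OF assms(2), of _ P]]
    by (auto simp: eval2_def N_def power2_eq_square)
  have bnd: "\<bar>coeff_xx P\<bar> \<le> 6 * N" "\<bar>coeff_xy P\<bar> \<le> 6 * N" "\<bar>coeff_yy P\<bar> \<le> 6 * N"
    using a b c by linarith+
  have N: "N \<ge> 0" using a by linarith
  have "coeff_norm q P \<le> (3 * (6 * N) powr q) powr (1 / q)"
    unfolding coeff_norm_def
  proof (rule powr_mono2)
    have "\<bar>x\<bar> powr q \<le> (6 * N) powr q" if "\<bar>x\<bar> \<le> 6 * N" for x
      using that assms by (intro powr_mono2) auto
    from this[OF bnd(1)] this[OF bnd(2)] this[OF bnd(3)]
    show "\<bar>coeff_xx P\<bar> powr q + \<bar>coeff_xy P\<bar> powr q + \<bar>coeff_yy P\<bar> powr q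
        \<le> 3 * (6 * N) powr q" by linarith
  qed (use assms in auto)
  also have "\<dots> = 6 * 3 powr (1 / q) * N"
    using assms N by (simp add: powr_mult powr_powr)
  finally show "coeff_norm q P \<le> 6 * 3 powr (1 / q) * poly_norm p P" by (simp add: N_def)
qed simp

lemma best_const_is_least:
  assumes "q \<ge> 1" "p \<ge> 1"
  shows "is_bound_const q p (best_const q p) \<and>
    (\<forall>K. is_bound_const q p K \<longrightarrow> best_const q p \<le> K)"
proof -
  define S where "S = {K. is_bound_const q p K}"
  have ne: "S \<noteq> {}" using is_bound_const_exists[OF assms] by (auto simp: S_def)
  define Q where "Q = HomPoly2 1 0 0"
  have nQ: "poly_norm p Q \<le> 1"
    unfolding poly_norm_def
  proof (rule cSUP_least)
    have "lp_norm p (0, 0) \<le> 1" by (auto simp: lp_norm_def)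
    then show "{z. lp_norm p z \<le> 1} \<noteq> {}" by blast
    fix z assume "z \<in> {z. lp_norm p z \<le> 1}"
    then have "\<bar>fst z\<bar> \<le> 1" using lp_norm_ge(1)[OF assms(2), of z] by simp
    then show "\<bar>eval2 Q z\<bar> \<le> 1" by (simp add: eval2_def Q_def abs_square_le_1)
  qed
  have lb: "1 \<le> K" if "K \<in> S" for K
  proof -
    have "1 = coeff_norm q Q" by (simp add: coeff_norm_def Q_def)
    also have "\<dots> \<le> K * poly_norm p Q" using that by (auto simp: S_def is_bound_const_def)
    also have "\<dots> \<le> K * 1"
      using that nQ by (intro mult_left_mono) (auto simp: S_def is_bound_const_def)
    finally show ?thesis by simp
  qed
  have bdd: "bdd_below S" using lb by (rule bdd_belowI)
  have low: "Inf S \<le> K" if "K \<in> S" for K using that bdd by (rule cInf_lower)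
  have "1 \<le> Inf S" using ne lb by (rule cInf_greatest)
  moreover have "coeff_norm q P \<le> Inf S * poly_norm p P" for P
  proof -
    have "lp_norm p (0, 0) \<le> 1" by (auto simp: lp_norm_def)
    from poly_norm_upper[OF assms(2) this, of P] have N: "poly_norm p P \<ge> 0" by linarith
    have le: "coeff_norm q P \<le> K * poly_norm p P" if "K \<in> S" for K
      using that by (auto simp: S_def is_bound_const_def)
    show ?thesis
    proof (cases "poly_norm p P = 0")
      case True
      then show ?thesis using ne le by auto
    next
      case False
      with N have pos: "poly_norm p P > 0" by simp
      have "coeff_norm q P / poly_norm p P \<le> Inf S"
        using ne by (rule cInf_greatest) (use le pos in \<open>simp add: divide_le_eq\<close>)
      then show ?thesis using pos by (simp add: divide_le_eq)
    qed
  qed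
  ultimately have "is_bound_const q p (Inf S)" by (simp add: is_bound_const_def)
  moreover from this have "best_const q p = Inf S"
    unfolding best_const_def by (rule Least_equality) (use low in \<open>auto simp: S_def\<close>)
  ultimately show ?thesis using low by (auto simp: S_def)
qed

lemma is_bound_const_best_const:
  "q \<ge> 1 \<Longrightarrow> p \<ge> 1 \<Longrightarrow> is_bound_const q p (best_const q p)"
  using best_const_is_least by blast

lemma best_const_le:
  "q \<ge> 1 \<Longrightarrow> p \<ge> 1 \<Longrightarrow> is_bound_const q p K \<Longrightarrow> best_const q p \<le> K"
  using best_const_is_least by blast

end

theory Submission
  imports Defs
begin

text \<open>
  Both constants are found by dominating coefficients. Let \<open>P = a x\<^sup>2 + b x y + c y\<^sup>2\<close> have
  supremum at most one on the unit ball, and put \<open>A = max \<bar>a\<bar> \<bar>c\<bar>\<close>. The reflections and the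
  swap of the coordinates and the change \<open>P \<mapsto> - P\<close> preserve the norms; they show that the
  ``worst'' polynomial with these data, \<open>A x\<^sup>2 + \<bar>b\<bar> x y - A y\<^sup>2\<close>, is bounded by one on the
  positive quarter of the ball (\<open>exists_dominating_point\<close>). Testing this at one
  well chosen point gives a discriminant inequality between \<open>A\<close> and \<open>\<bar>b\<bar>\<close>, which says that
  the coefficients of \<open>P\<close> are dominated by those of a member of an explicit curve of
  polynomials \<open>r x\<^sup>2 + s x y - r y\<^sup>2\<close> (\<open>dominated_by_extremal_one\<close>,
  \<open>dominated_by_extremal_inf\<close>). When \<open>\<bar>b\<bar>\<close> (for the octahedral norm) or \<open>A\<close> (for the supremum
  norm) is small, the bounds on the coefficients given by single points such as \<open>(1, 0)\<close> and
  \<open>(1, 1)\<close> already show that the first polynomial of the curve dominates.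

  Conversely the same discriminant, now zero, makes every member of the curve belong to the
  unit ball. As the coefficient norm is monotone, the best constant is the maximum of the
  coefficient norm along the curve, and this norm is \<open>f_one\<close> or \<open>f_inf\<close>.

  Now let \<open>q \<ge> 2\<close>. Along the curve the absolute values of the coefficients are at most \<open>4\<close> for
  \<open>p = 1\<close> and at most \<open>1\<close> for \<open>p = \<infinity>\<close>. Divided by this bound they become numbers \<open>x \<in> [0, 1]\<close>,
  for which \<open>x powr q \<le> x\<^sup>2\<close>. This reduces the maximisation to the case \<open>q = 2\<close>, in which a
  quadratic polynomial in \<open>t\<close> is to be maximised.
\<close>

section \<open>Reduction to a curve of extremal polynomials\<close>

definition unit_poly :: "ereal \<Rightarrow> hom_poly2 \<Rightarrow> bool" where
  "unit_poly p P \<longleftrightarrow> (\<forall>z. lp_norm p z \<le> 1 \<longrightarrow> \<bar>eval2 P z\<bar> \<le> 1)"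

definition dominated :: "hom_poly2 \<Rightarrow> hom_poly2 \<Rightarrow> bool" where
  "dominated P Q \<longleftrightarrow> \<bar>coeff_xx P\<bar> \<le> \<bar>coeff_xx Q\<bar> \<and> \<bar>coeff_xy P\<bar> \<le> \<bar>coeff_xy Q\<bar> \<and>
     \<bar>coeff_yy P\<bar> \<le> \<bar>coeff_yy Q\<bar>"

lemma coeff_norm_mono:
  assumes "q \<ge> 1" "dominated P Q"
  shows "coeff_norm q P \<le> coeff_norm q Q"
  using assms unfolding coeff_norm_def dominated_def
  by (intro powr_mono2 add_mono) auto

lemma coeff_norm_scale:
  assumes "q \<ge> 1" "s \<ge> 0"
  shows "coeff_norm q (HomPoly2 (s * a) (s * b) (s * c)) = s * coeff_norm q (HomPoly2 a b c)"
proof -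
  have "\<bar>s * a\<bar> powr q + \<bar>s * b\<bar> powr q + \<bar>s * c\<bar> powr q =
      s powr q * (\<bar>a\<bar> powr q + \<bar>b\<bar> powr q + \<bar>c\<bar> powr q)"
    using assms by (simp add: abs_mult powr_mult distrib_left)
  then show ?thesis
    using assms by (simp add: coeff_norm_def powr_mult powr_powr)
qed

text \<open>Only polynomials of norm at most one matter: any \<open>P\<close> is scaled by
  \<open>1 / (\<parallel>P\<parallel> + \<epsilon>)\<close>, where \<open>\<epsilon>\<close> avoids a separate treatment of \<open>\<parallel>P\<parallel> = 0\<close>.\<close>

lemma is_bound_const_if_unit_poly:
  assumes q: "q \<ge> 1" and p: "p \<ge> 1" and K: "K > 0"
    and bound: "\<And>P. unit_poly p P \<Longrightarrow> coeff_norm q P \<le> K"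
  shows "is_bound_const q p K"
  unfolding is_bound_const_def
proof (intro conjI allI K)
  fix P
  obtain a b c where P: "P = HomPoly2 a b c" by (cases P)
  have zero: "lp_norm p (0, 0) \<le> 1" by (simp add: lp_norm_def)
  have N: "poly_norm p P \<ge> 0" using poly_norm_upper[OF p zero, of P] by linarith
  show "coeff_norm q P \<le> K * poly_norm p P"
  proof (rule field_le_epsilon)
    fix e :: real assume e: "e > 0"
    define M where "M = poly_norm p P + e / K"
    have M: "M > 0" unfolding M_def using N K e by (intro add_nonneg_pos) auto
    let ?Q = "HomPoly2 (1 / M * a) (1 / M * b) (1 / M * c)"
    have "unit_poly p ?Q"
      unfolding unit_poly_def
    proof (intro allI impI)
      fix z assume "lp_norm p z \<le> 1"
      then have "\<bar>eval2 P z\<bar> \<le> poly_norm p P" by (rule poly_norm_upper[OF p])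
      also have "\<dots> \<le> M" using K e by (simp add: M_def)
      finally have "\<bar>eval2 P z\<bar> / M \<le> 1" using M by simp
      moreover have "eval2 ?Q z = eval2 P z / M"
        by (simp add: eval2_def P add_divide_distrib)
      ultimately show "\<bar>eval2 ?Q z\<bar> \<le> 1" using M by simp
    qed
    from bound[OF this] have "1 / M * coeff_norm q P \<le> K"
      using coeff_norm_scale[OF q, of "1 / M" a b c] M P by simp
    then have "coeff_norm q P \<le> K * M" using M by (simp add: field_simps)
    also have "\<dots> = K * poly_norm p P + e" using K by (simp add: M_def distrib_left)
    finally show "coeff_norm q P \<le> K * poly_norm p P + e" .
  qed
qed

lemma best_const_eq_max:
  assumes q: "q \<ge> 1" and p: "p \<ge> 1"
    and unit: "\<And>t. t \<in> T \<Longrightarrow> unit_poly p (E t)"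
    and norm: "\<And>t. t \<in> T \<Longrightarrow> coeff_norm q (E t) = f t"
    and dom: "\<And>P. unit_poly p P \<Longrightarrow> \<exists>t\<in>T. dominated P (E t)"
    and max: "max_on f T \<in> f ` T" "\<And>t. t \<in> T \<Longrightarrow> f t \<le> max_on f T"
  shows "best_const q p = max_on f T"
proof (rule antisym)
  have upper: "coeff_norm q P \<le> max_on f T" if "unit_poly p P" for P
    using dom[OF that] coeff_norm_mono[OF q] norm max(2) by (metis order_trans)
  have "unit_poly p (HomPoly2 1 0 0)"
    unfolding unit_poly_def
    using order_trans[OF lp_norm_ge(1)[OF p]] by (simp add: eval2_def abs_square_le_1)
  from upper[OF this] have pos: "max_on f T > 0" by (simp add: coeff_norm_def)
  show "best_const q p \<le> max_on f T"
    using q p by (intro best_const_le is_bound_const_if_unit_poly pos upper)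
  obtain t where t: "t \<in> T" "max_on f T = f t" using max(1) by auto
  have "poly_norm p (E t) \<le> 1"
    unfolding poly_norm_def
  proof (rule cSUP_least)
    have "lp_norm p (0, 0) \<le> 1" by (simp add: lp_norm_def)
    then show "{z. lp_norm p z \<le> 1} \<noteq> {}" by blast
  qed (use unit[OF t(1)] in \<open>auto simp: unit_poly_def\<close>)
  moreover have "best_const q p > 0" "coeff_norm q (E t) \<le> best_const q p * poly_norm p (E t)"
    using is_bound_const_best_const[OF q p] by (auto simp: is_bound_const_def)
  ultimately have "coeff_norm q (E t) \<le> best_const q p * 1"
    by (meson less_imp_le mult_left_mono order_trans)
  then show "max_on f T \<le> best_const q p" using t norm[OF t(1)] by simp
qed

text \<open>If \<open>\<bar>c\<bar> \<le> \<bar>a\<bar>\<close>, a sign of \<open>P\<close> makes the \<open>x\<^sup>2\<close>-term positive and a reflection of \<open>y\<close> then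
  makes the mixed term positive, while the \<open>y\<^sup>2\<close>-term is at least \<open>- \<bar>a\<bar> y\<^sup>2\<close>; otherwise the
  coordinates are swapped first.\<close>

lemma exists_dominating_point:
  assumes "x \<ge> 0" "y \<ge> 0" and A: "A = max \<bar>coeff_xx P\<bar> \<bar>coeff_yy P\<bar>"
  shows "\<exists>z. lp_norm p z = lp_norm p (x, y) \<and>
    A * x\<^sup>2 + \<bar>coeff_xy P\<bar> * x * y - A * y\<^sup>2 \<le> \<bar>eval2 P z\<bar>"
proof -
  have main: "\<exists>w\<in>{y, - y}. \<bar>a\<bar> * x\<^sup>2 + \<bar>b\<bar> * x * y - \<bar>a\<bar> * y\<^sup>2 \<le> \<bar>a * x\<^sup>2 + b * x * w + c * w\<^sup>2\<bar>"
    if ca: "\<bar>c\<bar> \<le> \<bar>a\<bar>" for a b c :: real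
  proof -
    have "\<bar>c * y\<^sup>2\<bar> \<le> \<bar>a\<bar> * y\<^sup>2"
      using ca by (simp add: abs_mult mult_right_mono)
    then show ?thesis
      by (cases "a \<ge> 0"; cases "b \<ge> 0"; simp; linarith)
  qed
  show ?thesis
  proof (cases "\<bar>coeff_yy P\<bar> \<le> \<bar>coeff_xx P\<bar>")
    case True
    from main[OF this, of "coeff_xy P"] obtain w where w: "w \<in> {y, - y}"
      "\<bar>coeff_xx P\<bar> * x\<^sup>2 + \<bar>coeff_xy P\<bar> * x * y - \<bar>coeff_xx P\<bar> * y\<^sup>2 \<le> \<bar>eval2 P (x, w)\<bar>"
      by (simp only: eval2_def fst_conv snd_conv) blast
    moreover have "lp_norm p (x, w) = lp_norm p (x, y)"
      using w(1) by (auto simp: lp_norm_def)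
    ultimately show ?thesis using A True by (intro exI[of _ "(x, w)"]) simp
  next
    case False
    then have "\<bar>coeff_xx P\<bar> \<le> \<bar>coeff_yy P\<bar>" by simp
    from main[OF this, of "coeff_xy P"] obtain w where w: "w \<in> {y, - y}"
      and le: "\<bar>coeff_yy P\<bar> * x\<^sup>2 + \<bar>coeff_xy P\<bar> * x * y - \<bar>coeff_yy P\<bar> * y\<^sup>2
        \<le> \<bar>coeff_yy P * x\<^sup>2 + coeff_xy P * x * w + coeff_xx P * w\<^sup>2\<bar>"
      by blast
    have "eval2 P (w, x) = coeff_yy P * x\<^sup>2 + coeff_xy P * x * w + coeff_xx P * w\<^sup>2"
      by (simp add: eval2_def)
    moreover have "lp_norm p (w, x) = lp_norm p (x, y)"
      using w(1) by (auto simp: lp_norm_def add.commute max.commute)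
    ultimately show ?thesis using A False le by (intro exI[of _ "(w, x)"]) simp
  qed
qed

lemma unit_poly_test:
  assumes "unit_poly p P" "x \<ge> 0" "y \<ge> 0" "lp_norm p (x, y) \<le> 1"
    and "A = max \<bar>coeff_xx P\<bar> \<bar>coeff_yy P\<bar>"
  shows "A * x\<^sup>2 + \<bar>coeff_xy P\<bar> * x * y - A * y\<^sup>2 \<le> 1"
  using exists_dominating_point[OF assms(2,3,5), of p] assms(1,4)
  unfolding unit_poly_def by (metis order_trans)

section \<open>The octahedral norm\<close>

definition extremal_one :: "real \<Rightarrow> hom_poly2" where
  "extremal_one t = HomPoly2 (sqrt (4 * t - t\<^sup>2) / 2) t (- (sqrt (4 * t - t\<^sup>2) / 2))"

lemma lp_norm_1: "lp_norm 1 z = \<bar>fst z\<bar> + \<bar>snd z\<bar>"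
  by (simp add: lp_norm_def)

lemma parabola_nonneg: "0 \<le> t \<Longrightarrow> t \<le> 4 \<Longrightarrow> 0 \<le> 4 * t - (t::real)\<^sup>2"
  using mult_nonneg_nonneg[of t "4 - t"] by (simp add: power2_eq_square algebra_simps)

lemma coeff_norm_extremal_one:
  assumes "q \<ge> 1" "t \<in> {2..4}"
  shows "coeff_norm q (extremal_one t) = f_one q t"
proof -
  have nn: "0 \<le> 4 * t - t\<^sup>2" using assms parabola_nonneg by simp
  have "2 powr (1 - q) * (4 * t - t\<^sup>2) powr (q / 2) = 2 * (sqrt (4 * t - t\<^sup>2) / 2) powr q"
    using nn by (simp add: powr_divide powr_diff powr_half_sqrt[symmetric] powr_powr)
  then show ?thesis
    using assms nn by (simp add: coeff_norm_def f_one_def extremal_one_def)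
qed

text \<open>The form \<open>(x + y)\<^sup>2 - (r x\<^sup>2 + t x y - r y\<^sup>2)\<close> has discriminant
  \<open>(t - 2)\<^sup>2 - 4 (1 - r\<^sup>2) = 0\<close>, hence is a nonnegative multiple of a square. This bounds the
  polynomial from above on the positive quadrant; reflections and the swap of the coordinates,
  which turn \<open>r\<close> and \<open>t\<close> into \<open>- r\<close> or \<open>- t\<close>, do the rest.\<close>

lemma unit_poly_extremal_one:
  assumes "t \<in> {2..4}"
  shows "unit_poly 1 (extremal_one t)"
proof -
  define r where "r = sqrt (4 * t - t\<^sup>2) / 2"
  have nn: "0 \<le> 4 * t - t\<^sup>2" using assms parabola_nonneg by simp
  have r2: "4 * r\<^sup>2 = 4 * t - t\<^sup>2" and r0: "r \<ge> 0"
    using nn by (auto simp: r_def power_divide)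
  have disc: "4 * ((1 - r) * (1 + r)) = (t - 2)\<^sup>2"
    using r2 by (simp add: power2_eq_square algebra_simps)
  have quad: "r * x\<^sup>2 + t * (x * y) - r * y\<^sup>2 \<le> (x + y)\<^sup>2"
    if "x \<ge> 0" "y \<ge> 0" for x y :: real
  proof -
    have "4 * (1 + r) * ((x + y)\<^sup>2 - (r * x\<^sup>2 + t * (x * y) - r * y\<^sup>2)) =
        4 * ((1 - r) * (1 + r)) * x\<^sup>2 - 4 * (1 + r) * (t - 2) * (x * y) + (2 * (1 + r) * y)\<^sup>2"
      by (simp add: power2_eq_square algebra_simps)
    also have "\<dots> = ((t - 2) * x - 2 * (1 + r) * y)\<^sup>2"
      unfolding disc by (simp add: power2_eq_square algebra_simps)
    finally have "0 \<le> 4 * (1 + r) * ((x + y)\<^sup>2 - (r * x\<^sup>2 + t * (x * y) - r * y\<^sup>2))" by simp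
    then show ?thesis using r0 by (simp add: zero_le_mult_iff)
  qed
  show ?thesis
    unfolding unit_poly_def
  proof (intro allI impI)
    fix z :: "real \<times> real" assume z: "lp_norm 1 z \<le> 1"
    obtain x y where xy: "z = (x, y)" by (cases z)
    have ball: "(\<bar>x\<bar> + \<bar>y\<bar>)\<^sup>2 \<le> 1" using z by (simp add: xy lp_norm_1 abs_square_le_1)
    have "\<bar>t * (x * y)\<bar> = t * (\<bar>x\<bar> * \<bar>y\<bar>)" using assms by (simp add: abs_mult)
    moreover have "eval2 (extremal_one t) z = r * x\<^sup>2 + t * (x * y) - r * y\<^sup>2"
      by (simp add: eval2_def extremal_one_def xy r_def)
    moreover have "r * x\<^sup>2 + t * (\<bar>x\<bar> * \<bar>y\<bar>) - r * y\<^sup>2 \<le> 1"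
      "r * y\<^sup>2 + t * (\<bar>x\<bar> * \<bar>y\<bar>) - r * x\<^sup>2 \<le> 1"
      using quad[of "\<bar>x\<bar>" "\<bar>y\<bar>"] quad[of "\<bar>y\<bar>" "\<bar>x\<bar>"] ball
      by (simp_all add: add.commute mult.commute)
    ultimately show "\<bar>eval2 (extremal_one t) z\<bar> \<le> 1" by linarith
  qed
qed

lemma dominated_by_extremal_one:
  assumes P: "unit_poly 1 P"
  shows "\<exists>t\<in>{2..4}. dominated P (extremal_one t)"
proof -
  define A where "A = max \<bar>coeff_xx P\<bar> \<bar>coeff_yy P\<bar>"
  define t where "t = \<bar>coeff_xy P\<bar>"
  have A0: "A \<ge> 0" by (simp add: A_def)
  have A1: "A \<le> 1"
    using unit_poly_test[OF P, of 1 0, OF _ _ _ A_def] by (simp add: lp_norm_1)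
  have coeffs: "\<bar>coeff_xx P\<bar> \<le> A" "\<bar>coeff_yy P\<bar> \<le> A" by (auto simp: A_def)
  show ?thesis
  proof (cases "t \<le> 2")
    case True
    then have "dominated P (extremal_one 2)"
      using coeffs A1 by (simp add: dominated_def extremal_one_def t_def)
    then show ?thesis by force
  next
    case False
    then have t2: "t > 2" by simp
    \<comment> \<open>The direction that minimises \<open>(x + y)\<^sup>2 - (A x\<^sup>2 + t x y - A y\<^sup>2)\<close> for fixed \<open>x\<close>. Fixing
        \<open>y\<close> instead would lead to a division by \<open>1 - A\<close>, which may vanish.\<close>
    define k where "k = 2 * (1 + A) + (t - 2)"
    have k: "k > 0" using A0 t2 by (simp add: k_def)
    have "lp_norm 1 (2 * (1 + A) / k, (t - 2) / k) = 1"
      using k A0 t2 by (simp add: lp_norm_1 add_divide_distrib[symmetric] k_def)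
    then have "A * (2 * (1 + A) / k)\<^sup>2 + t * (2 * (1 + A) / k) * ((t - 2) / k)
        - A * ((t - 2) / k)\<^sup>2 \<le> 1"
      using unit_poly_test[OF P, of "2 * (1 + A) / k" "(t - 2) / k", OF _ _ _ A_def] k A0 t2
      by (simp add: t_def)
    also have "A * (2 * (1 + A) / k)\<^sup>2 + t * (2 * (1 + A) / k) * ((t - 2) / k)
        - A * ((t - 2) / k)\<^sup>2 =
        (A * (2 * (1 + A))\<^sup>2 + t * (2 * (1 + A)) * (t - 2) - A * (t - 2)\<^sup>2) / k\<^sup>2"
      using k by (simp add: power2_eq_square field_simps)
    finally have "A * (2 * (1 + A))\<^sup>2 + t * (2 * (1 + A)) * (t - 2) - A * (t - 2)\<^sup>2 \<le> k\<^sup>2"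
      using k by simp
    then have "0 \<le> (1 + A) * ((4 * t - t\<^sup>2) - (2 * A)\<^sup>2)"
      by (simp add: k_def power2_eq_square algebra_simps)
    then have A2: "(2 * A)\<^sup>2 \<le> 4 * t - t\<^sup>2" using A0 by (simp add: zero_le_mult_iff)
    then have "0 \<le> 4 * t - t\<^sup>2" by (rule order_trans[rotated]) simp
    then have "0 \<le> t * (4 - t)" by (simp add: power2_eq_square algebra_simps)
    then have t4: "t \<le> 4" using t2 by (simp add: zero_le_mult_iff)
    have "2 * A \<le> sqrt (4 * t - t\<^sup>2)" using A2 by (rule real_le_rsqrt)
    then have "dominated P (extremal_one t)"
      using coeffs by (auto simp: dominated_def extremal_one_def t_def[symmetric])
    then show ?thesis using t2 t4 by force
  qed
qed

section \<open>The supremum norm\<close>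

definition extremal_inf :: "real \<Rightarrow> hom_poly2" where
  "extremal_inf t = HomPoly2 t (2 * sqrt (t * (1 - t))) (- t)"

lemma lp_norm_inf: "lp_norm \<infinity> z = max \<bar>fst z\<bar> \<bar>snd z\<bar>"
  by (simp add: lp_norm_def)

lemma coeff_norm_extremal_inf:
  assumes "t \<in> {1/2..1}"
  shows "coeff_norm q (extremal_inf t) = f_inf q t"
proof -
  have "2 powr q * t powr (q / 2) * (1 - t) powr (q / 2) = (2 * sqrt (t * (1 - t))) powr q"
    using assms by (simp add: powr_mult powr_half_sqrt[symmetric] powr_powr)
  then show ?thesis
    using assms by (simp add: coeff_norm_def f_inf_def extremal_inf_def)
qed

text \<open>Completing the square in \<open>y\<close> gives \<open>P(x, y) \<le> x\<^sup>2\<close>. As \<open>P(y, - x) = - P(x, y)\<close>, it also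
  gives \<open>- P(x, y) \<le> y\<^sup>2\<close>.\<close>

lemma unit_poly_extremal_inf:
  assumes "t \<in> {1/2..1}"
  shows "unit_poly \<infinity> (extremal_inf t)"
proof -
  define s where "s = sqrt (t * (1 - t))"
  have s2: "s\<^sup>2 = t * (1 - t)" using assms by (simp add: s_def)
  have quad: "t * x\<^sup>2 + 2 * s * (x * y) - t * y\<^sup>2 \<le> x\<^sup>2" for x y :: real
  proof -
    have "t * (x\<^sup>2 - (t * x\<^sup>2 + 2 * s * (x * y) - t * y\<^sup>2)) =
        (t * (1 - t)) * x\<^sup>2 - 2 * s * t * (x * y) + (t * y)\<^sup>2"
      by (simp add: power2_eq_square algebra_simps)
    also have "\<dots> = (s * x - t * y)\<^sup>2"
      unfolding s2[symmetric] by (simp add: power2_eq_square algebra_simps)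
    finally have "0 \<le> t * (x\<^sup>2 - (t * x\<^sup>2 + 2 * s * (x * y) - t * y\<^sup>2))" by simp
    then show ?thesis using assms by (simp add: zero_le_mult_iff)
  qed
  show ?thesis
    unfolding unit_poly_def
  proof (intro allI impI)
    fix z :: "real \<times> real" assume z: "lp_norm \<infinity> z \<le> 1"
    obtain x y where xy: "z = (x, y)" by (cases z)
    have "x\<^sup>2 \<le> 1" "y\<^sup>2 \<le> 1" using z by (auto simp: xy lp_norm_inf abs_square_le_1)
    moreover have "eval2 (extremal_inf t) z = t * x\<^sup>2 + 2 * s * (x * y) - t * y\<^sup>2"
      by (simp add: eval2_def extremal_inf_def xy s_def)
    ultimately show "\<bar>eval2 (extremal_inf t) z\<bar> \<le> 1"
      using quad[of x y] quad[of y "- x"] by (simp add: abs_le_iff mult.commute)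
  qed
qed

lemma dominated_by_extremal_inf:
  assumes P: "unit_poly \<infinity> P"
  shows "\<exists>t\<in>{1/2..1}. dominated P (extremal_inf t)"
proof -
  define A where "A = max \<bar>coeff_xx P\<bar> \<bar>coeff_yy P\<bar>"
  define B where "B = \<bar>coeff_xy P\<bar>"
  have test: "A + B * y - A * y\<^sup>2 \<le> 1" if "0 \<le> y" "y \<le> 1" for y
    using unit_poly_test[OF P, of 1 y, OF _ _ _ A_def] that by (simp add: lp_norm_inf B_def)
  have A0: "A \<ge> 0" and B0: "B \<ge> 0" by (simp_all add: A_def B_def)
  have A1: "A \<le> 1" using test[of 0] by simp
  have B1: "B \<le> 1" using test[of 1] by simp
  have coeffs: "\<bar>coeff_xx P\<bar> \<le> A" "\<bar>coeff_yy P\<bar> \<le> A" by (auto simp: A_def)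
  show ?thesis
  proof (cases "A \<le> 1/2")
    case True
    have "sqrt (1 / 2 * (1 - 1 / 2)) = (1 / 2 :: real)"
      by (rule real_sqrt_unique) (auto simp: power2_eq_square)
    then have "dominated P (extremal_inf (1/2))"
      using coeffs B1 True by (simp add: dominated_def extremal_inf_def B_def)
    then show ?thesis by force
  next
    case False
    then have A: "A > 1/2" by simp
    \<comment> \<open>The vertex of the parabola in \<open>test\<close>; it lies in the unit interval because
        \<open>B \<le> 1 < 2 A\<close>.\<close>
    have "A + B * (B / (2 * A)) - A * (B / (2 * A))\<^sup>2 \<le> 1"
      using A B0 B1 by (intro test) auto
    also have "A + B * (B / (2 * A)) - A * (B / (2 * A))\<^sup>2 = A + (B / 2)\<^sup>2 / A"
      using A by (simp add: power2_eq_square field_simps)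
    finally have "(B / 2)\<^sup>2 / A \<le> 1 - A" by simp
    then have "(B / 2)\<^sup>2 \<le> A * (1 - A)"
      using A by (simp add: divide_le_eq mult.commute)
    then have "B / 2 \<le> sqrt (A * (1 - A))" by (rule real_le_rsqrt)
    then have "dominated P (extremal_inf A)"
      using coeffs A0 by (simp add: dominated_def extremal_inf_def B_def)
    then show ?thesis using A A1 by force
  qed
qed

section \<open>The maxima for exponents at least two\<close>

lemma powr_le_square: "q \<ge> 2 \<Longrightarrow> 0 \<le> x \<Longrightarrow> x \<le> 1 \<Longrightarrow> x powr q \<le> (x::real)\<^sup>2"
  using powr_mono'[of 2 q x] by simp

lemma coeff_norm_leI:
  assumes "q \<ge> 1" "K \<ge> 0"
    and "\<bar>coeff_xx P\<bar> powr q + \<bar>coeff_xy P\<bar> powr q + \<bar>coeff_yy P\<bar> powr q \<le> K"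
  shows "coeff_norm q P \<le> K powr (1 / q)"
  unfolding coeff_norm_def using assms by (intro powr_mono2) auto

lemma max_f_one:
  assumes q: "q \<ge> 2"
  shows "max_on (f_one q) {2..4} = 4"
proof (rule antisym)
  have q1: "q \<ge> 1" using q by simp
  obtain t where t: "t \<in> {2..4}" "max_on (f_one q) {2..4} = f_one q t"
    using f_one_max(1)[OF q1] by auto
  define r where "r = sqrt (4 * t - t\<^sup>2) / 2"
  have nn: "0 \<le> 4 * t - t\<^sup>2" using t parabola_nonneg by simp
  have r2: "4 * r\<^sup>2 = 4 * t - t\<^sup>2" and r0: "r \<ge> 0"
    using nn by (auto simp: r_def power_divide)
  have "4 * r\<^sup>2 + (t - 2)\<^sup>2 = 4" using r2 by (simp add: power2_eq_square algebra_simps)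
  then have "r\<^sup>2 \<le> 1" using zero_le_power2[of "t - 2"] by linarith
  then have r1: "r \<le> 1" using abs_square_le_1[of r] by simp
  have "2 * (r / 4) powr q + (t / 4) powr q \<le> 2 * (r / 4)\<^sup>2 + (t / 4)\<^sup>2"
    using powr_le_square[OF q, of "r / 4"] powr_le_square[OF q, of "t / 4"] r0 r1 t by simp
  also have "\<dots> \<le> 1"
  proof -
    have "t * t \<le> 4 * 4" using t by (intro mult_mono) auto
    then show ?thesis using r2 t by (simp add: power2_eq_square)
  qed
  finally have "4 powr q * (2 * (r / 4) powr q + (t / 4) powr q) \<le> 4 powr q * 1"
    by (intro mult_left_mono) auto
  then have "2 * r powr q + t powr q \<le> 4 powr q"
    using r0 t by (simp add: powr_divide distrib_left)
  then have "coeff_norm q (extremal_one t) \<le> (4 powr q) powr (1 / q)"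
    using q1 r0 t by (intro coeff_norm_leI) (auto simp: extremal_one_def r_def[symmetric])
  then show "max_on (f_one q) {2..4} \<le> 4"
    using coeff_norm_extremal_one[OF q1 t(1)] t(2) q by (simp add: powr_powr)
  have "f_one q 4 = 4" using q by (simp add: f_one_def powr_powr)
  then show "4 \<le> max_on (f_one q) {2..4}" using f_one_max(2)[OF q1, of 4] by simp
qed

lemma max_f_inf:
  assumes q: "q \<ge> 2"
  shows "max_on (f_inf q) {1/2..1} = 2 powr (1 / q)"
proof (rule antisym)
  have q1: "q \<ge> 1" using q by simp
  obtain t where t: "t \<in> {1/2..1}" "max_on (f_inf q) {1/2..1} = f_inf q t"
    using f_inf_max(1)[OF q1] by auto
  define s where "s = 2 * sqrt (t * (1 - t))"
  have s0: "s \<ge> 0" and s2: "s\<^sup>2 = 4 * (t * (1 - t))"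
    using t by (auto simp: s_def power_mult_distrib)
  have "s\<^sup>2 + (2 * t - 1)\<^sup>2 = 1" using s2 by (simp add: power2_eq_square algebra_simps)
  then have "s\<^sup>2 \<le> 1" using zero_le_power2[of "2 * t - 1"] by linarith
  then have s1: "s \<le> 1" using abs_square_le_1[of s] by simp
  have "2 * t powr q + s powr q \<le> 2 * t\<^sup>2 + s\<^sup>2"
    using powr_le_square[OF q, of t] powr_le_square[OF q, of s] s0 s1 t by simp
  also have "\<dots> = 2 - 2 * (1 - t)\<^sup>2" using s2 by (simp add: power2_eq_square algebra_simps)
  also have "\<dots> \<le> 2" by simp
  finally have "coeff_norm q (extremal_inf t) \<le> 2 powr (1 / q)"
    using q1 s0 t by (intro coeff_norm_leI) (auto simp: extremal_inf_def s_def[symmetric])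
  then show "max_on (f_inf q) {1/2..1} \<le> 2 powr (1 / q)"
    using coeff_norm_extremal_inf[OF t(1)] t(2) by simp
  have "f_inf q 1 = 2 powr (1 / q)" using q by (simp add: f_inf_def)
  then show "2 powr (1 / q) \<le> max_on (f_inf q) {1/2..1}" using f_inf_max(2)[OF q1, of 1] by simp
qed

section \<open>The best constants\<close>

theorem theorem2p5:
  "(\<forall>q::real. q \<ge> 1 \<longrightarrow>
      best_const q 1 = max_on (f_one q) {2..4} \<and>
      best_const q \<infinity> = max_on (f_inf q) {1/2..1}) \<and>
   (\<forall>q::real. q \<ge> 2 \<longrightarrow>
      best_const q 1 = 4 \<and>
      best_const q \<infinity> = 2 powr (1 / q))"
proof -
  have one: "best_const q 1 = max_on (f_one q) {2..4}" if "q \<ge> 1" for q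
    using that by (intro best_const_eq_max[where E = extremal_one] unit_poly_extremal_one
      coeff_norm_extremal_one dominated_by_extremal_one f_one_max) simp_all
  have inf: "best_const q \<infinity> = max_on (f_inf q) {1/2..1}" if "q \<ge> 1" for q
    using that by (intro best_const_eq_max[where E = extremal_inf] unit_poly_extremal_inf
      coeff_norm_extremal_inf dominated_by_extremal_inf f_inf_max) simp_all
  show ?thesis using one inf max_f_one max_f_inf by simp
qed

end
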